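(* Let $X$ be a Banach two-sided $\mathbb{H}$-module, let $D(A)$ be a right $\mathbb{H}$-submodule of $X$ and let $A : D(A)\to X$ be a closed right linear operator such that $\rho_S(A)\cap\mathbb{R}\neq\varnothing$. If $q_0\in\rho_S(A)$, then $$\mathrm{u}(q_0,\sigma_S(A))\ge\frac{1}{\|Q_{q_0}(A)\|^{1/2}}.$$
   Context: $\mathbb{H}$ is the real algebra of quaternions with conjugation $q\mapsto\overline{q}$, real part $\operatorname{Re}(q)$ and norm $|q|=\sqrt{q\overline{q}}$; $\mathbb{R}\subset\mathbb{H}$ is the set of real quaternions. A two-sided $\mathbb{H}$-module is an abelian group $X$ with left and right scalar multiplications by $\mathbb{H}$, biadditive and unital, with $p(qx)=(pq)x$, $(xp)q=x(pq)$, $p(xq)=(px)q$ for $p,q\in\mathbb{H}$, and $rx=xr$ for $r\in\mathbb{R}$. It is a Banach two-sided $\mathbb{H}$-module if it has a norm (definite, subadditive) with $\|qx\|=\|xq\|=|q|\|x\|$ for which it is complete. A right $\mathbb{H}$-submodule is a subgroup closed under right scalar multiplication. A map $A:D(A)\to X$ on a right $\mathbb{H}$-submodule is right linear if it is additive and $A(xq)=A(x)q$; it is closed if its graph is closed in $X\times X$. $D(A^2):=\{x\in D(A):Ax\in D(A)\}$, $A^2x:=A(Ax)$. $\mathscr{L}^r(X)$ is the set of right linear $B:X\to X$ with $\|B\|:=\sup\{\|Bx\|:\|x\|\le1\}<\infty$. For $q\in\mathbb{H}$, $\Delta_q(A):=A^2-2\operatorname{Re}(q)A+|q|^2\mathrm{Id}:D(A^2)\to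 X$. $\rho_S(A):=\{q\in\mathbb{H}:\Delta_q(A)\text{ is bijective and }\Delta_q(A)^{-1}\in\mathscr{L}^r(X)\}$ and $\sigma_S(A):=\mathbb{H}\setminus\rho_S(A)$. For $q\in\rho_S(A)$: $Q_q(A):=\Delta_q(A)^{-1}$. For $p,q\in\mathbb{H}$, $\triangle_q(p):=p^2-2\operatorname{Re}(q)p+|q|^2$ and $\mathrm{u}(p,q):=\sqrt{|\triangle_q(p)|}$ (the Cassini pseudo-metric). For $T\subset\mathbb{H}$, $\mathrm{u}(q_0,T):=\inf_{p\in T}\mathrm{u}(p,q_0)$ if $T\neq\varnothing$ and $\mathrm{u}(q_0,\varnothing):=+\infty$. Convention for the degenerate case $X=\{0\}$: $1/0^{1/2}:=+\infty$. *)

theory Defs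
  imports "HOL-Analysis.Analysis"
begin

section \<open>Quaternions\<close>

datatype quat = Quat (qRe: real) (qI: real) (qJ: real) (qK: real)

lemma quat_eq_iff: "p = q \<longleftrightarrow> qRe p = qRe q \<and> qI p = qI q \<and> qJ p = qJ q \<and> qK p = qK q"
  by (auto intro: quat.expand)

instantiation quat :: real_vector
begin

definition "0 = Quat 0 0 0 0"
definition "p + q = Quat (qRe p + qRe q) (qI p + qI q) (qJ p + qJ q) (qK p + qK q)"
definition "p - q = Quat (qRe p - qRe q) (qI p - qI q) (qJ p - qJ q) (qK p - qK q)"
definition "- q = Quat (- qRe q) (- qI q) (- qJ q) (- qK q)"
definition "r *\<^sub>R q = Quat (r * qRe q) (r * qI q) (r * qJ q) (r * qK q)"

instance
  by standard
    (auto simp: quat_eq_iff zero_quat_def plus_quat_def minus_quat_def uminus_quat_def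
      scaleR_quat_def algebra_simps)

end

lemma quat_sel_simps [simp]:
  "qRe 0 = 0" "qI 0 = 0" "qJ 0 = 0" "qK 0 = 0"
  "qRe (p + q) = qRe p + qRe q" "qI (p + q) = qI p + qI q"
  "qJ (p + q) = qJ p + qJ q" "qK (p + q) = qK p + qK q"
  "qRe (p - q) = qRe p - qRe q" "qI (p - q) = qI p - qI q"
  "qJ (p - q) = qJ p - qJ q" "qK (p - q) = qK p - qK q"
  "qRe (- q) = - qRe q" "qI (- q) = - qI q" "qJ (- q) = - qJ q" "qK (- q) = - qK q"
  "qRe (r *\<^sub>R q) = r * qRe q" "qI (r *\<^sub>R q) = r * qI q"
  "qJ (r *\<^sub>R q) = r * qJ q" "qK (r *\<^sub>R q) = r * qK q"
  by (simp_all add: zero_quat_def plus_quat_def minus_quat_def uminus_quat_def scaleR_quat_def)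

instantiation quat :: real_algebra_1
begin

definition "1 = Quat 1 0 0 0"

definition "p * q = Quat
  (qRe p * qRe q - qI p * qI q - qJ p * qJ q - qK p * qK q)
  (qRe p * qI q + qI p * qRe q + qJ p * qK q - qK p * qJ q)
  (qRe p * qJ q - qI p * qK q + qJ p * qRe q + qK p * qI q)
  (qRe p * qK q + qI p * qJ q - qJ p * qI q + qK p * qRe q)"

instance
proof
  fix p q s :: quat and r :: real
  show "p * q * s = p * (q * s)"
    unfolding times_quat_def quat_eq_iff quat.sel by (intro conjI; algebra)
  show "(p + q) * s = p * s + q * s" "p * (q + s) = p * q + p * s"
    unfolding times_quat_def quat_eq_iff quat.sel quat_sel_simps by (intro conjI; algebra)+
  show "1 * q = q" "q * 1 = q"
    unfolding times_quat_def one_quat_def quat_eq_iff by simp_all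
  show "r *\<^sub>R p * q = r *\<^sub>R (p * q)" "p * r *\<^sub>R q = r *\<^sub>R (p * q)"
    unfolding times_quat_def quat_eq_iff quat.sel quat_sel_simps by (intro conjI; algebra)+
  show "0 \<noteq> (1 :: quat)"
    unfolding one_quat_def quat_eq_iff by simp
qed

end

lemma quat_one_sel [simp]: "qRe 1 = 1" "qI 1 = 0" "qJ 1 = 0" "qK 1 = 0"
  by (simp_all add: one_quat_def)

lemma quat_times_sel [simp]:
  "qRe (p * q) = qRe p * qRe q - qI p * qI q - qJ p * qJ q - qK p * qK q"
  "qI (p * q) = qRe p * qI q + qI p * qRe q + qJ p * qK q - qK p * qJ q"
  "qJ (p * q) = qRe p * qJ q - qI p * qK q + qJ p * qRe q + qK p * qI q"
  "qK (p * q) = qRe p * qK q + qI p * qJ q - qJ p * qI q + qK p * qRe q"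
  by (simp_all add: times_quat_def)

lemma quat_of_real_sel [simp]:
  "qRe (of_real r) = r" "qI (of_real r) = 0" "qJ (of_real r) = 0" "qK (of_real r) = 0"
  by (simp_all add: of_real_def)

definition qcnj :: "quat \<Rightarrow> quat"
  where "qcnj q = Quat (qRe q) (- qI q) (- qJ q) (- qK q)"

lemma qcnj_sel [simp]:
  "qRe (qcnj q) = qRe q" "qI (qcnj q) = - qI q" "qJ (qcnj q) = - qJ q" "qK (qcnj q) = - qK q"
  by (simp_all add: qcnj_def)

instantiation quat :: real_normed_div_algebra
begin

definition norm_quat :: "quat \<Rightarrow> real"
  where "norm q = sqrt ((qRe q)\<^sup>2 + (qI q)\<^sup>2 + (qJ q)\<^sup>2 + (qK q)\<^sup>2)"
definition dist_quat_def: "dist (p::quat) q = norm (p - q)"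
definition sgn_quat_def: "sgn (q::quat) = q /\<^sub>R norm q"
definition [code del]: "uniformity = (INF e\<in>{0<..}. principal {(p::quat, q). dist p q < e})"
definition [code del]:
  "open (U :: quat set) \<longleftrightarrow> (\<forall>p\<in>U. eventually (\<lambda>(p', q). p' = p \<longrightarrow> q \<in> U) uniformity)"
definition inverse_quat_def: "inverse (q::quat) = qcnj q /\<^sub>R (norm q)\<^sup>2"
definition divide_quat_def: "(p::quat) div q = p * inverse q"

instance
proof
  have norm_eq: "norm q = norm ((qRe q, qI q), (qJ q, qK q))" for q
    by (simp add: norm_quat_def norm_Pair)
  have norm_sq: "(norm q)\<^sup>2 = (qRe q)\<^sup>2 + (qI q)\<^sup>2 + (qJ q)\<^sup>2 + (qK q)\<^sup>2" for q
    by (simp add: norm_quat_def)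
  fix p q :: quat and r :: real and U :: "quat set"
  show norm0: "norm q = 0 \<longleftrightarrow> q = 0" for q :: quat
    unfolding norm_eq norm_eq_zero by (simp add: quat_eq_iff zero_prod_def)
  show "norm (p + q) \<le> norm p + norm q"
    unfolding norm_eq
    using norm_triangle_ineq[of "((qRe p, qI p), (qJ p, qK p))" "((qRe q, qI q), (qJ q, qK q))"]
    by simp
  show "norm (r *\<^sub>R q) = \<bar>r\<bar> * norm q"
    unfolding norm_eq
    using norm_scaleR[of r "((qRe q, qI q), (qJ q, qK q))"] by simp
  show "norm (p * q) = norm p * norm q"
    by (rule power2_eq_imp_eq)
      (unfold power_mult_distrib norm_sq quat_times_sel, algebra, simp_all add: norm_quat_def)
  have "q * qcnj q = of_real ((norm q)\<^sup>2)" "qcnj q * q = of_real ((norm q)\<^sup>2)"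
    unfolding norm_sq quat_eq_iff quat_of_real_sel by (simp_all add: power2_eq_square)
  then show "q \<noteq> 0 \<Longrightarrow> inverse q * q = 1" "q \<noteq> 0 \<Longrightarrow> q * inverse q = 1"
    by (simp_all add: inverse_quat_def norm0 of_real_def del: of_real_power)
  show "inverse (0::quat) = 0"
    by (simp add: inverse_quat_def quat_eq_iff)
qed (simp_all add: dist_quat_def sgn_quat_def uniformity_quat_def open_quat_def divide_quat_def)

end

lemma quat_mult_qcnj: "q * qcnj q = of_real ((norm q)\<^sup>2)"
  by (simp add: norm_quat_def quat_eq_iff power2_eq_square)


section \<open>Banach two-sided modules over the quaternions\<close>

text \<open>
  The compatibility \<open>r x = x r\<close> for real \<open>r\<close> is expressed by identifying both sides with the
  scalar multiplication of the underlying real vector space, which carries no further data.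
\<close>

class quat_bimodule = real_vector +
  fixes lscale :: "quat \<Rightarrow> 'a \<Rightarrow> 'a"  (infixr \<open>*\<^sub>l\<close> 76)
    and rscale :: "'a \<Rightarrow> quat \<Rightarrow> 'a"  (infixl \<open>*\<^sub>r\<close> 75)
  assumes lscale_add_right: "q *\<^sub>l (x + y) = q *\<^sub>l x + q *\<^sub>l y"
    and lscale_add_left: "(p + q) *\<^sub>l x = p *\<^sub>l x + q *\<^sub>l x"
    and rscale_add_left: "(x + y) *\<^sub>r q = x *\<^sub>r q + y *\<^sub>r q"
    and rscale_add_right: "x *\<^sub>r (p + q) = x *\<^sub>r p + x *\<^sub>r q"
    and lscale_one: "1 *\<^sub>l x = x"
    and rscale_one: "x *\<^sub>r 1 = x"
    and lscale_lscale: "p *\<^sub>l (q *\<^sub>l x) = (p * q) *\<^sub>l x"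
    and rscale_rscale: "(x *\<^sub>r p) *\<^sub>r q = x *\<^sub>r (p * q)"
    and lscale_rscale: "p *\<^sub>l (x *\<^sub>r q) = (p *\<^sub>l x) *\<^sub>r q"
    and lscale_of_real: "of_real r *\<^sub>l x = r *\<^sub>R x"
    and rscale_of_real: "x *\<^sub>r of_real r = r *\<^sub>R x"

class banach_quat_bimodule = quat_bimodule + banach +
  assumes norm_lscale: "norm (q *\<^sub>l x) = norm q * norm x"
    and norm_rscale: "norm (x *\<^sub>r q) = norm q * norm x"

definition right_submodule :: "'x::quat_bimodule set \<Rightarrow> bool" where
  "right_submodule D \<longleftrightarrow>
     0 \<in> D \<and> (\<forall>x\<in>D. \<forall>y\<in>D. x + y \<in> D) \<and> (\<forall>x\<in>D. - x \<in> D) \<and> (\<forall>x\<in>D. \<forall>q. x *\<^sub>r q \<in> D)"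


section \<open>Right linear operators\<close>

text \<open>
  An operator \<open>A : D(A) \<rightarrow> X\<close> is given by its domain \<open>D\<close> and a function \<open>A\<close> whose values outside
  \<open>D\<close> are irrelevant.
\<close>

definition right_linear_on :: "'x::quat_bimodule set \<Rightarrow> ('x \<Rightarrow> 'x) \<Rightarrow> bool" where
  "right_linear_on D A \<longleftrightarrow>
     (\<forall>x\<in>D. \<forall>y\<in>D. A (x + y) = A x + A y) \<and> (\<forall>x\<in>D. \<forall>q. A (x *\<^sub>r q) = A x *\<^sub>r q)"

definition closed_operator :: "'x::banach_quat_bimodule set \<Rightarrow> ('x \<Rightarrow> 'x) \<Rightarrow> bool" where
  "closed_operator D A \<longleftrightarrow> closed ((\<lambda>x. (x, A x)) ` D)"

definition bounded_right_linear :: "('x::banach_quat_bimodule \<Rightarrow> 'x) \<Rightarrow> bool" where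
  "bounded_right_linear B \<longleftrightarrow>
     right_linear_on UNIV B \<and> bdd_above ((\<lambda>x. norm (B x)) ` {x. norm x \<le> 1})"

definition op_norm :: "('x::banach_quat_bimodule \<Rightarrow> 'x) \<Rightarrow> real" where
  "op_norm B = (SUP x\<in>{x. norm x \<le> 1}. norm (B x))"

definition square_domain :: "'x set \<Rightarrow> ('x \<Rightarrow> 'x) \<Rightarrow> 'x set" where
  "square_domain D A = {x \<in> D. A x \<in> D}"


section \<open>The S-spectrum\<close>

definition Delta_op :: "('x::banach_quat_bimodule \<Rightarrow> 'x) \<Rightarrow> quat \<Rightarrow> 'x \<Rightarrow> 'x" where
  "Delta_op A q x = A (A x) - (2 * qRe q) *\<^sub>R A x + (norm q)\<^sup>2 *\<^sub>R x"

definition Q_op :: "'x::banach_quat_bimodule set \<Rightarrow> ('x \<Rightarrow> 'x) \<Rightarrow> quat \<Rightarrow> 'x \<Rightarrow> 'x" where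
  "Q_op D A q = inv_into (square_domain D A) (Delta_op A q)"

definition S_resolvent_set :: "'x::banach_quat_bimodule set \<Rightarrow> ('x \<Rightarrow> 'x) \<Rightarrow> quat set" where
  "S_resolvent_set D A =
     {q. bij_betw (Delta_op A q) (square_domain D A) UNIV \<and> bounded_right_linear (Q_op D A q)}"

definition S_spectrum :: "'x::banach_quat_bimodule set \<Rightarrow> ('x \<Rightarrow> 'x) \<Rightarrow> quat set" where
  "S_spectrum D A = - S_resolvent_set D A"


section \<open>The Cassini pseudo-metric\<close>

definition Delta_quat :: "quat \<Rightarrow> quat \<Rightarrow> quat" where
  "Delta_quat q p = p\<^sup>2 - of_real (2 * qRe q) * p + of_real ((norm q)\<^sup>2)"

definition cassini :: "quat \<Rightarrow> quat \<Rightarrow> real" where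
  "cassini p q = sqrt (norm (Delta_quat q p))"

text \<open>The infimum is taken in the extended reals, so it is \<open>\<infinity>\<close> for \<open>T = {}\<close>;
  likewise \<open>1 / 0 = \<infinity>\<close> in \<open>ereal\<close>.\<close>

definition cassini_set :: "quat \<Rightarrow> quat set \<Rightarrow> ereal" where
  "cassini_set q T = (INF p\<in>T. ereal (cassini p q))"

end

theory Submission
  imports Defs
begin

text \<open>
  Write \<open>\<Delta>\<^sub>q(p) = p\<^sup>2 - 2 Re(q) p + |q|\<^sup>2\<close> for the quaternion \<^const>\<open>Delta_quat\<close>. The claim is that
  \<open>\<parallel>Q\<^sub>q(A)\<parallel> |\<Delta>\<^sub>q(p)| < 1\<close> forces \<open>p\<close> into the S-resolvent set. The idea is to replace the operator
  \<open>\<Delta>\<^sub>p(A)\<close> of second order by operators of first order: for a quaternion \<open>s\<close> let \<open>A - s\<close> denote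
  \<open>x \<mapsto> A x - x s\<close>, with \<open>s\<close> acting from the right. Since \<open>A\<close> is right linear, right multiplication
  by \<open>s\<close> commutes with \<open>A\<close>, and so \<open>X\<close> may be regarded as a complex Banach space on which \<open>p\<close> acts
  as a complex scalar. The price is that \<open>A - s\<close> is in general not right linear over the quaternions.
  Quadratic polynomials in \<open>A\<close> then factor as in the complex case:

  \<^item> \<open>\<Delta>\<^sub>p(A) = (A - p\<^sup>*) (A - p)\<close>, where \<open>p\<^sup>*\<close> is the conjugate of \<open>p\<close>
    (\<open>Delta_op_eq_shifted_qcnj\<close>);
  \<^item> \<open>\<Delta>\<^sub>q(A) - \<Delta>\<^sub>q(p) = (A - p) (A - w) = (A - w) (A - p)\<close> with \<open>w = 2 Re(q) - p\<close>
    (\<open>Delta_op_diff_eq_shifted\<close>).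

  If \<open>\<parallel>Q\<^sub>q(A)\<parallel> |\<Delta>\<^sub>q(p)| < 1\<close>, the left-hand side of the second identity is a small perturbation of the
  invertible operator \<open>\<Delta>\<^sub>q(A)\<close>, hence bijective; the factorisations in both orders then make
  \<open>A - p\<close> surjective and injective (\<open>bij_shifted\<close>). As \<open>\<Delta>\<^sub>q(p\<^sup>*)\<close> has the same norm as \<open>\<Delta>\<^sub>q(p)\<close>, the
  same holds for \<open>A - p\<^sup>*\<close>, and the first identity shows that \<open>\<Delta>\<^sub>p(A)\<close> is bijective. Its inverse is
  the composition of the inverses of \<open>A - p\<close> and \<open>A - p\<^sup>*\<close>, which are bounded by the closed graph
  theorem because \<open>A\<close> is closed (\<open>bounded_linear_inv_shifted\<close>, \<open>S_resolventI\<close>).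
\<close>

section \<open>The closed graph theorem\<close>

text \<open>
  The half of the closed graph theorem that rests on Baire's theorem: the sets
  \<open>{x. norm (T x) \<le> n}\<close> cover the space, so the closure of one of them contains a ball. By
  linearity the ball can be moved to the origin and rescaled, so that each \<open>y\<close> has an
  approximation \<open>u\<close> whose image is controlled by the norm of \<open>y\<close>. The relative error \<open>1 / 2\<close>
  makes the iterated approximation of the closed graph theorem converge geometrically.
\<close>

lemma linear_approx_preimage:
  fixes T :: "'a::banach \<Rightarrow> 'b::real_normed_vector"
  assumes T: "linear T"
  obtains M where "M \<ge> 0" "\<And>y. \<exists>u. norm (y - u) \<le> norm y / 2 \<and> norm (T u) \<le> M * norm y"
proof -
  interpret T: linear T by (rule T)
  define S where "S n = {x. norm (T x) \<le> real n}" for n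
  have "\<exists>n. interior (closure (S n)) \<noteq> {}"
  proof (rule ccontr)
    assume "\<not> ?thesis"
    then have "\<And>C. C \<in> range (\<lambda>n. closure (S n)) \<Longrightarrow> closedin euclidean C \<and> euclidean interior_of C = {}"
      by auto
    then have "euclidean interior_of (\<Union>(range (\<lambda>n. closure (S n)))) = {}"
      by (intro Baire_category_alt disjI1 completely_metrizable_space_euclidean) auto
    moreover have "\<Union>(range (\<lambda>n. closure (S n))) = UNIV"
    proof -
      have "x \<in> \<Union>(range (\<lambda>n. closure (S n)))" for x
      proof -
        obtain n where "norm (T x) \<le> real n" using real_arch_simple by blast
        then have "x \<in> S n" by (simp add: S_def)
        then show ?thesis using closure_subset by blast
      qed
      then show ?thesis by blast
    qed
    ultimately show False by simp
  qed
  then obtain n c where "c \<in> interior (closure (S n))" by blast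
  then obtain r where r: "r > 0" "ball c r \<subseteq> closure (S n)"
    by (meson mem_interior)
  \<comment> \<open>Differences of points near \<open>c + y\<close> and near \<open>c\<close> move the ball to the origin, at the cost of
    doubling the bound.\<close>
  have small: "\<exists>u. norm (y - u) \<le> e \<and> norm (T u) \<le> 2 * real n" if "norm y < r" "e > 0" for y e
  proof -
    have "c + y \<in> closure (S n)" "c \<in> closure (S n)"
      using r that by (auto simp: dist_norm subset_iff)
    then obtain u v where u: "u \<in> S n" "dist u (c + y) < e / 2" and v: "v \<in> S n" "dist v c < e / 2"
      unfolding closure_approachable using \<open>e > 0\<close> half_gt_zero by meson
    have "norm (y - (u - v)) \<le> norm (v - c) + norm (u - (c + y))"
      using norm_triangle_ineq4[of "v - c" "u - (c + y)"] by (simp add: algebra_simps)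
    then have "norm (y - (u - v)) \<le> e" using u v by (simp add: dist_norm)
    moreover have "norm (T (u - v)) \<le> 2 * real n"
      using u v norm_triangle_ineq4[of "T u" "T v"] by (simp add: S_def T.diff)
    ultimately show ?thesis by blast
  qed
  have "\<exists>u. norm (y - u) \<le> norm y / 2 \<and> norm (T u) \<le> (4 * real n / r) * norm y" for y
  proof (cases "y = 0")
    case True
    then show ?thesis by (intro exI[of _ 0]) (simp add: T.zero)
  next
    case False
    \<comment> \<open>Scale \<open>y\<close> to norm \<open>r / 2\<close>, inside the ball of radius \<open>r\<close>.\<close>
    define k where "k = r / (2 * norm y)"
    have k: "k > 0" "norm (k *\<^sub>R y) < r" using False r by (auto simp: k_def)
    obtain u where u: "norm (k *\<^sub>R y - u) \<le> k * (norm y / 2)" "norm (T u) \<le> 2 * real n"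
      using small[OF k(2), of "k * (norm y / 2)"] k False by auto
    have "norm (y - u /\<^sub>R k) = norm (k *\<^sub>R y - u) / k"
    proof -
      have "y - u /\<^sub>R k = (k *\<^sub>R y - u) /\<^sub>R k" using k by (simp add: algebra_simps)
      then show ?thesis using k by (simp add: divide_inverse_commute)
    qed
    also have "\<dots> \<le> norm y / 2" using u k by (simp add: field_simps)
    finally have 1: "norm (y - u /\<^sub>R k) \<le> norm y / 2" .
    have "norm (T (u /\<^sub>R k)) = norm (T u) / k"
      using k by (simp add: T.scale divide_inverse_commute)
    also have "\<dots> \<le> 2 * real n / k" using u k by (simp add: divide_right_mono)
    also have "\<dots> = (4 * real n / r) * norm y" using False r by (simp add: k_def field_simps)
    finally show ?thesis using 1 by blast
  qed
  then show ?thesis using r by (intro that[of "4 * real n / r"]) auto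
qed

text \<open>
  Subtracting approximations successively writes \<open>y\<close> as a series of vectors whose images are
  dominated by a geometric series. The images therefore have a sum of controlled norm, and the
  closed graph identifies this sum with \<open>T y\<close>.
\<close>

theorem closed_graph_theorem:
  fixes T :: "'a::banach \<Rightarrow> 'b::banach"
  assumes T: "linear T" and graph: "closed (range (\<lambda>x. (x, T x)))"
  shows "bounded_linear T"
proof -
  interpret T: linear T by (rule T)
  obtain M where M: "M \<ge> 0" "\<And>y. \<exists>u. norm (y - u) \<le> norm y / 2 \<and> norm (T u) \<le> M * norm y"
    using linear_approx_preimage[OF T] by blast
  then obtain g where g: "\<And>y. norm (y - g y) \<le> norm y / 2" "\<And>y. norm (T (g y)) \<le> M * norm y"
    by metis
  have "norm (T y) \<le> norm y * (2 * M)" for y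
  proof -
    \<comment> \<open>\<open>e n\<close> is the remainder of \<open>y\<close> after \<open>n\<close> approximation steps.\<close>
    define e where "e n = ((\<lambda>z. z - g z) ^^ n) y" for n
    have e_Suc: "e (Suc n) = e n - g (e n)" for n by (simp add: e_def)
    have e_le: "norm (e n) \<le> norm y * (1/2) ^ n" for n
    proof (induction n)
      case (Suc n)
      have "norm (e (Suc n)) \<le> norm (e n) / 2" unfolding e_Suc by (rule g)
      then show ?case using Suc by simp
    qed (simp add: e_def)
    have e_0: "e \<longlonglongrightarrow> 0"
    proof (rule Lim_null_comparison)
      show "(\<lambda>n. norm y * (1/2) ^ n) \<longlonglongrightarrow> 0"
        by (intro tendsto_mult_right_zero LIMSEQ_power_zero) simp
    qed (use e_le in auto)
    have sum_g: "(\<Sum>i<n. g (e i)) = y - e n" for n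
      by (induction n) (simp_all add: e_Suc, simp add: e_def)
    have Tg_le: "norm (T (g (e n))) \<le> M * norm y * (1/2) ^ n" for n
      using order_trans[OF g(2) mult_left_mono[OF e_le M(1)]] by (simp add: mult.assoc)
    have geo: "(\<lambda>n. M * norm y * (1/2) ^ n) sums (M * norm y * 2)"
      using sums_mult[OF geometric_sums[of "1/2::real"], of "M * norm y"] by simp
    have summ: "summable (\<lambda>n. T (g (e n)))"
      by (rule summable_comparison_test'[OF sums_summable[OF geo]]) (rule Tg_le)
    define z where "z = (\<Sum>n. T (g (e n)))"
    have "(\<lambda>n. \<Sum>i<n. T (g (e i))) \<longlonglongrightarrow> z"
      using summ by (simp add: z_def summable_LIMSEQ)
    then have Ts: "(\<lambda>n. T (y - e n)) \<longlonglongrightarrow> z"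
      by (simp add: sum_g[symmetric] T.sum)
    moreover have "(\<lambda>n. y - e n) \<longlonglongrightarrow> y"
      using tendsto_diff[OF tendsto_const e_0, of y] by simp
    ultimately have lim: "(\<lambda>n. (y - e n, T (y - e n))) \<longlonglongrightarrow> (y, z)"
      by (rule tendsto_Pair[rotated])
    have "(y, z) \<in> range (\<lambda>x. (x, T x))"
      by (rule closed_sequentially[OF graph _ lim]) auto
    then have "T y = z" by auto
    moreover have "norm z \<le> M * norm y * 2"
      unfolding z_def sums_unique[OF geo]
      by (rule norm_suminf_le[OF Tg_le sums_summable[OF geo]])
    ultimately show ?thesis by (simp add: mult_ac)
  qed
  then show ?thesis
    by (intro bounded_linear_intro[of T "2 * M"]) (auto simp: T.add T.scale)
qed


section \<open>Right scalar multiplication and bounded right linear maps\<close>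

lemma rscale_diff_left: "(x - y) *\<^sub>r q = x *\<^sub>r q - y *\<^sub>r q"
  using rscale_add_left[of "x - y" y q] by simp

lemma rscale_diff_right: "x *\<^sub>r (p - q) = x *\<^sub>r p - x *\<^sub>r q"
  using rscale_add_right[of x "p - q" q] by simp

text \<open>
  Real scalars may be taken to act from the left, where they commute with every right
  multiplication by the bimodule law.
\<close>

lemma rscale_scaleR_left: "(r *\<^sub>R x) *\<^sub>r q = r *\<^sub>R (x *\<^sub>r q)"
  by (metis lscale_of_real lscale_rscale)

lemma bounded_linear_rscale_left: "bounded_linear (\<lambda>x::'x::banach_quat_bimodule. x *\<^sub>r q)"
  by (intro bounded_linear_intro[of _ "norm q"])
    (auto simp: rscale_add_left rscale_scaleR_left norm_rscale)

lemma right_linear_imp_linear: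
  assumes "right_linear_on UNIV B"
  shows "linear B"
  using assms unfolding right_linear_on_def
  by (intro linearI) (auto simp flip: rscale_of_real)

lemma norm_le_op_norm:
  assumes B: "bounded_right_linear B"
  shows "norm (B x) \<le> op_norm B * norm x"
proof (cases "x = 0")
  case True
  interpret linear B using B by (auto simp: bounded_right_linear_def right_linear_imp_linear)
  show ?thesis using True by (simp add: zero)
next
  case False
  interpret linear B using B by (auto simp: bounded_right_linear_def right_linear_imp_linear)
  have "norm (B (x /\<^sub>R norm x)) \<le> op_norm B"
    unfolding op_norm_def using B False
    by (intro cSUP_upper) (auto simp: bounded_right_linear_def)
  then show ?thesis using False by (simp add: scale field_simps)
qed

lemma bounded_right_linearI:
  assumes "right_linear_on UNIV B" "bounded_linear B"
  shows "bounded_right_linear B"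
proof -
  obtain K where K: "K > 0" "\<And>x. norm (B x) \<le> norm x * K"
    using bounded_linear.pos_bounded[OF assms(2)] by blast
  have "norm (B x) \<le> K" if "norm x \<le> 1" for x
    using order_trans[OF K(2) mult_right_mono[OF that]] K(1) by simp
  then have "bdd_above ((\<lambda>x. norm (B x)) ` {x. norm x \<le> 1})"
    by (auto simp: bdd_above_def)
  with assms show ?thesis by (simp add: bounded_right_linear_def)
qed


section \<open>Operators shifted by a quaternion\<close>

text \<open>
  The operator \<open>A - s\<close>, with \<open>s\<close> acting by right multiplication. For right linear \<open>A\<close> it is real
  linear and commutes with right multiplication by those quaternions that commute with \<open>s\<close>, but it
  is in general not right linear over the quaternions.
\<close>

definition shifted :: "('x::quat_bimodule \<Rightarrow> 'x) \<Rightarrow> quat \<Rightarrow> 'x \<Rightarrow> 'x" where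
  "shifted A s x = A x - x *\<^sub>r s"

locale right_linear_operator =
  fixes D :: "'x::banach_quat_bimodule set" and A :: "'x \<Rightarrow> 'x"
  assumes submodule: "right_submodule D" and right_linear: "right_linear_on D A"
begin

lemma dom_closed:
  "0 \<in> D" "x \<in> D \<Longrightarrow> y \<in> D \<Longrightarrow> x + y \<in> D" "x \<in> D \<Longrightarrow> - x \<in> D" "x \<in> D \<Longrightarrow> x *\<^sub>r q \<in> D"
  using submodule by (auto simp: right_submodule_def)

lemma dom_diff: "x \<in> D \<Longrightarrow> y \<in> D \<Longrightarrow> x - y \<in> D"
  using dom_closed(2)[of x "- y"] dom_closed(3)[of y] by simp

lemma dom_scaleR: "x \<in> D \<Longrightarrow> r *\<^sub>R x \<in> D"
  using dom_closed(4)[of x "of_real r"] by (simp add: rscale_of_real)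

lemma A_add: "x \<in> D \<Longrightarrow> y \<in> D \<Longrightarrow> A (x + y) = A x + A y"
  and A_rscale: "x \<in> D \<Longrightarrow> A (x *\<^sub>r q) = A x *\<^sub>r q"
  using right_linear by (auto simp: right_linear_on_def)

lemma A_diff: "x \<in> D \<Longrightarrow> y \<in> D \<Longrightarrow> A (x - y) = A x - A y"
  using A_add[of "x - y" y] dom_diff by simp

lemma A_scaleR: "x \<in> D \<Longrightarrow> A (r *\<^sub>R x) = r *\<^sub>R A x"
  using A_rscale[of x "of_real r"] by (simp add: rscale_of_real)

text \<open>
  The domain of \<open>A\<^sup>2\<close> is also the domain of every product of two shifted operators, since the
  shift \<open>x s\<close> stays in \<open>D\<close>.
\<close>

lemma square_domain_iff: "x \<in> square_domain D A \<longleftrightarrow> x \<in> D \<and> shifted A s x \<in> D"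
proof -
  have "x \<in> D \<Longrightarrow> A x - x *\<^sub>r s \<in> D \<Longrightarrow> A x \<in> D"
    using dom_closed(2)[of "A x - x *\<^sub>r s" "x *\<^sub>r s"] dom_closed(4) by simp
  then show ?thesis
    by (auto simp: square_domain_def shifted_def intro: dom_diff dom_closed)
qed

lemma shifted_add: "x \<in> D \<Longrightarrow> y \<in> D \<Longrightarrow> shifted A s (x + y) = shifted A s x + shifted A s y"
  by (simp add: shifted_def A_add rscale_add_left)

lemma shifted_diff: "x \<in> D \<Longrightarrow> y \<in> D \<Longrightarrow> shifted A s (x - y) = shifted A s x - shifted A s y"
  by (simp add: shifted_def A_diff rscale_diff_left)

lemma shifted_scaleR: "x \<in> D \<Longrightarrow> shifted A s (r *\<^sub>R x) = r *\<^sub>R shifted A s x"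
  by (simp add: shifted_def A_scaleR rscale_scaleR_left scaleR_diff_right)

text \<open>
  Right multiplications compose in reverse order, so \<open>t * s\<close> appears and not \<open>s * t\<close>.
\<close>

lemma shifted_shifted:
  assumes "x \<in> square_domain D A"
  shows "shifted A s (shifted A t x) = A (A x) - A x *\<^sub>r (t + s) + x *\<^sub>r (t * s)"
  using assms
  by (simp add: square_domain_def shifted_def A_diff A_rscale dom_closed rscale_diff_left
      rscale_add_right rscale_rscale)

text \<open>
  A quaternion and its conjugate have sum \<open>2 Re(p)\<close> and product \<open>|p|\<^sup>2\<close>, the coefficients of \<open>\<Delta>\<^sub>p\<close>.
\<close>

lemma Delta_op_eq_shifted_qcnj:
  assumes "x \<in> square_domain D A"
  shows "Delta_op A p x = shifted A (qcnj p) (shifted A p x)"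
proof -
  have "p + qcnj p = of_real (2 * qRe p)"
    by (simp add: quat_eq_iff del: of_real_mult)
  then show ?thesis
    unfolding shifted_shifted[OF assms] quat_mult_qcnj by (simp only: Delta_op_def rscale_of_real)
qed

text \<open>
  The polynomial \<open>z\<^sup>2 - 2 Re(q) z + |q|\<^sup>2 - \<Delta>\<^sub>q(p)\<close> vanishes at \<open>p\<close>; the other root is
  \<open>w = 2 Re(q) - p\<close> because the roots must add up to \<open>2 Re(q)\<close>, and it commutes with \<open>p\<close>. Having
  \<open>A - p\<close> as left factor will give its surjectivity, having it as right factor its injectivity.
\<close>

lemma Delta_op_diff_eq_shifted:
  fixes p q :: quat
  assumes "x \<in> square_domain D A"
  defines "w \<equiv> of_real (2 * qRe q) - p"
  shows "Delta_op A q x - x *\<^sub>r Delta_quat q p = shifted A p (shifted A w x)"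
    and "Delta_op A q x - x *\<^sub>r Delta_quat q p = shifted A w (shifted A p x)"
proof -
  have wp: "w * p = of_real ((norm q)\<^sup>2) - Delta_quat q p"
    unfolding w_def Delta_quat_def by (simp add: left_diff_distrib power2_eq_square)
  have "p * w = w * p" and sum: "w + p = of_real (2 * qRe q)" "p + w = of_real (2 * qRe q)"
    by (simp_all add: w_def quat_eq_iff algebra_simps del: of_real_mult)
  with wp have pw: "p * w = of_real ((norm q)\<^sup>2) - Delta_quat q p" by simp
  show "Delta_op A q x - x *\<^sub>r Delta_quat q p = shifted A p (shifted A w x)"
    unfolding shifted_shifted[OF assms(1)] sum wp
    by (simp only: Delta_op_def rscale_of_real rscale_diff_right add_diff_eq)
  show "Delta_op A q x - x *\<^sub>r Delta_quat q p = shifted A w (shifted A p x)"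
    unfolding shifted_shifted[OF assms(1)] sum pw
    by (simp only: Delta_op_def rscale_of_real rscale_diff_right add_diff_eq)
qed

lemma Delta_op_right_linear: "right_linear_on (square_domain D A) (Delta_op A q)"
  unfolding right_linear_on_def Delta_op_def square_domain_def
  by (auto simp: A_add A_rscale rscale_add_left rscale_diff_left rscale_scaleR_left algebra_simps)

lemma square_domain_submodule: "right_submodule (square_domain D A)"
proof -
  have "A 0 = 0" using A_diff[of 0 0] dom_closed(1) by simp
  moreover have "A (- x) = - A x" if "x \<in> D" for x
    using A_diff[of 0 x] dom_closed(1) that \<open>A 0 = 0\<close> by simp
  ultimately show ?thesis
    unfolding right_submodule_def square_domain_def by (auto simp: A_add A_rscale dom_closed)
qed

text \<open>
  The coefficients of \<open>\<Delta>\<^sub>q(A)\<close> are real, so it is right linear even though its factors need not be,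
  and its inverse inherits this.
\<close>

lemma right_linear_Q_op:
  assumes "bij_betw (Delta_op A q) (square_domain D A) UNIV"
  shows "right_linear_on UNIV (Q_op D A q)"
proof -
  have Q: "Q_op D A q y \<in> square_domain D A" "Delta_op A q (Q_op D A q y) = y" for y
    using assms unfolding Q_op_def bij_betw_def by (auto intro: inv_into_into f_inv_into_f)
  have Q_eq: "Q_op D A q (Delta_op A q x) = x" if "x \<in> square_domain D A" for x
    using assms that unfolding Q_op_def by (simp add: bij_betw_inv_into_left)
  show ?thesis
    unfolding right_linear_on_def
  proof (intro conjI ballI allI)
    fix x y :: 'x and p :: quat
    show "Q_op D A q (x + y) = Q_op D A q x + Q_op D A q y"
      using Q_eq[of "Q_op D A q x + Q_op D A q y"] Q Delta_op_right_linear square_domain_submodule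
      unfolding right_linear_on_def right_submodule_def by simp
    show "Q_op D A q (x *\<^sub>r p) = Q_op D A q x *\<^sub>r p"
      using Q_eq[of "Q_op D A q x *\<^sub>r p"] Q Delta_op_right_linear square_domain_submodule
      unfolding right_linear_on_def right_submodule_def by simp
  qed
qed

lemma inj_on_shiftedI:
  assumes "\<And>x. x \<in> D \<Longrightarrow> shifted A s x = 0 \<Longrightarrow> x = 0"
  shows "inj_on (shifted A s) D"
proof (rule inj_onI)
  fix x y assume "x \<in> D" "y \<in> D" "shifted A s x = shifted A s y"
  then show "x = y" using assms[of "x - y"] by (simp add: dom_diff shifted_diff)
qed

text \<open>
  The core of the argument: \<open>\<Delta>\<^sub>q(A) - \<Delta>\<^sub>q(p)\<close> equals \<open>(1 - B) \<Delta>\<^sub>q(A)\<close> with \<open>B u = Q\<^sub>q(A) u \<Delta>\<^sub>q(p)\<close>, and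
  \<open>B\<close> has norm less than 1, so \<open>1 - B\<close> is bijective. The factorisations transfer this to \<open>A - p\<close>.
\<close>

lemma bij_shifted:
  assumes q: "q \<in> S_resolvent_set D A"
    and small: "op_norm (Q_op D A q) * norm (Delta_quat q p) < 1"
  shows "bij_betw (shifted A p) D UNIV"
proof -
  define f where "f = Delta_quat q p"
  define Q where "Q = Q_op D A q"
  define N where "N = op_norm Q"
  have bij: "bij_betw (Delta_op A q) (square_domain D A) UNIV" and bdd: "bounded_right_linear Q"
    using q by (auto simp: S_resolvent_set_def Q_def)
  interpret Q: linear Q using bdd by (auto simp: bounded_right_linear_def right_linear_imp_linear)
  have Q: "Q y \<in> square_domain D A" "Delta_op A q (Q y) = y" for y
    using bij unfolding Q_def Q_op_def bij_betw_def by (auto intro: inv_into_into f_inv_into_f)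
  have Q_le: "norm (Q x) \<le> N * norm x" for x
    unfolding N_def by (rule norm_le_op_norm[OF bdd])
  have small': "N * norm f < 1" using small by (simp add: N_def f_def Q_def)
  have N0: "N \<ge> 0"
    unfolding N_def op_norm_def using bdd
    by (intro cSUP_upper2[where x = 0]) (auto simp: bounded_right_linear_def)
  have "inj_on (shifted A p) D"
  proof (rule inj_on_shiftedI)
    \<comment> \<open>A vector in the kernel of \<open>A - p\<close> lies in the domain of \<open>A\<^sup>2\<close> and satisfies
      \<open>\<Delta>\<^sub>q(A) x = x \<Delta>\<^sub>q(p)\<close>, so it is fixed by a linear map of norm less than 1.\<close>
    fix x assume x: "x \<in> D" "shifted A p x = 0"
    then have sq: "x \<in> square_domain D A" by (simp add: square_domain_iff[of x p] dom_closed)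
    have "shifted A (of_real (2 * qRe q) - p) 0 = 0"
      using shifted_diff[of 0 0] dom_closed(1) by simp
    with x have "Delta_op A q x = x *\<^sub>r f"
      using Delta_op_diff_eq_shifted(2)[OF sq, where p = p and q = q] by (simp add: f_def)
    then have "x = Q (x *\<^sub>r f)"
      using sq bij unfolding Q_def Q_op_def by (metis bij_betw_inv_into_left)
    then have "norm x \<le> (N * norm f) * norm x"
      using Q_le[of "x *\<^sub>r f"] by (simp add: norm_rscale mult.assoc)
    then have "(1 - N * norm f) * norm x \<le> 0" by (simp add: algebra_simps)
    then show "x = 0" using small' by (simp add: mult_le_0_iff)
  qed
  moreover have "y \<in> shifted A p ` D" for y
  proof -
    \<comment> \<open>Solve \<open>(1 - B) u = y\<close> as a fixed point equation; then \<open>(A - w) (Q u)\<close> is a preimage of \<open>y\<close>.\<close>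
    have "dist (y + Q u *\<^sub>r f) (y + Q v *\<^sub>r f) \<le> (N * norm f) * dist u v" for u v
    proof -
      have "dist (y + Q u *\<^sub>r f) (y + Q v *\<^sub>r f) = norm f * norm (Q (u - v))"
        by (simp add: dist_norm Q.diff norm_rscale flip: rscale_diff_left)
      also have "\<dots> \<le> norm f * (N * norm (u - v))" by (intro mult_left_mono Q_le) simp
      finally show ?thesis by (simp add: dist_norm mult_ac)
    qed
    then obtain u where u: "y + Q u *\<^sub>r f = u"
      using banach_fix_type[of "N * norm f" "\<lambda>u. y + Q u *\<^sub>r f"] small' N0 by auto
    have "shifted A p (shifted A (of_real (2 * qRe q) - p) (Q u)) = y"
      using Delta_op_diff_eq_shifted(1)[OF Q(1), where p = p and q = q] u Q(2)[of u] unfolding f_def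
      by (metis add_diff_cancel_right')
    moreover have "shifted A (of_real (2 * qRe q) - p) (Q u) \<in> D"
      using Q(1)[of u] square_domain_iff by blast
    ultimately show ?thesis by blast
  qed
  ultimately show ?thesis by (auto simp: bij_betw_def)
qed

text \<open>
  The graph of the inverse of \<open>A - s\<close> is the preimage of the graph of \<open>A\<close> under the
  continuous map \<open>(y, x) \<mapsto> (x, y + x s)\<close>, so it is closed.
\<close>

lemma bounded_linear_inv_shifted:
  assumes closed_op: "closed_operator D A" and bij: "bij_betw (shifted A s) D UNIV"
  shows "bounded_linear (inv_into D (shifted A s))"
proof (rule closed_graph_theorem)
  let ?R = "inv_into D (shifted A s)"
  have R: "?R y \<in> D" "shifted A s (?R y) = y" for y
    using bij unfolding bij_betw_def by (auto intro: inv_into_into f_inv_into_f)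
  have R_eq: "?R (shifted A s x) = x" if "x \<in> D" for x
    using bij that by (simp add: bij_betw_inv_into_left)
  show "linear ?R"
  proof (rule linearI)
    show "?R (x + y) = ?R x + ?R y" for x y
      using R_eq[of "?R x + ?R y"] by (simp add: R dom_closed shifted_add)
    show "?R (r *\<^sub>R x) = r *\<^sub>R ?R x" for r x
      using R_eq[of "r *\<^sub>R ?R x"] by (simp add: R dom_scaleR shifted_scaleR)
  qed
  let ?h = "\<lambda>(y, x :: 'x). (x, y + x *\<^sub>r s)"
  have "range (\<lambda>y. (y, ?R y)) = ?h -` ((\<lambda>x. (x, A x)) ` D)"
  proof (intro equalityI subsetI)
    fix z assume "z \<in> range (\<lambda>y. (y, ?R y))"
    then obtain y where z: "z = (y, ?R y)" by blast
    have "A (?R y) = y + ?R y *\<^sub>r s" using R(2)[of y] by (simp add: shifted_def algebra_simps)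
    then show "z \<in> ?h -` ((\<lambda>x. (x, A x)) ` D)" using R(1)[of y] by (auto simp: z)
  next
    fix z assume "z \<in> ?h -` ((\<lambda>x. (x, A x)) ` D)"
    then obtain y x where z: "z = (y, x)" "x \<in> D" "y + x *\<^sub>r s = A x" by (cases z) auto
    then have "shifted A s x = y" by (simp add: shifted_def flip: z(3))
    then have "?R y = x" using R_eq[OF z(2)] by simp
    then show "z \<in> range (\<lambda>y. (y, ?R y))" using z(1) by blast
  qed
  moreover have "continuous_on UNIV ?h"
    unfolding case_prod_beta
    by (intro continuous_intros bounded_linear.continuous_on[OF bounded_linear_rscale_left])
  ultimately show "closed (range (\<lambda>y. (y, ?R y)))"
    using closed_op by (simp add: closed_operator_def closed_vimage)
qed

lemma S_resolventI:
  assumes closed_op: "closed_operator D A"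
    and bij: "bij_betw (shifted A p) D UNIV" "bij_betw (shifted A (qcnj p)) D UNIV"
  shows "p \<in> S_resolvent_set D A"
proof -
  let ?R = "\<lambda>s. inv_into D (shifted A s)"
  have R: "?R s y \<in> D" "shifted A s (?R s y) = y" if "bij_betw (shifted A s) D UNIV" for y s
    using that unfolding bij_betw_def by (auto intro: inv_into_into f_inv_into_f)
  have R_eq: "?R s (shifted A s x) = x" if "bij_betw (shifted A s) D UNIV" "x \<in> D" for x s
    using that by (simp add: bij_betw_inv_into_left)
  have right_inv: "?R p (?R (qcnj p) y) \<in> square_domain D A"
      "Delta_op A p (?R p (?R (qcnj p) y)) = y" for y
  proof -
    show *: "?R p (?R (qcnj p) y) \<in> square_domain D A"
      by (simp add: square_domain_iff[of _ p] R bij)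
    show "Delta_op A p (?R p (?R (qcnj p) y)) = y"
      by (simp add: Delta_op_eq_shifted_qcnj[OF *] R bij)
  qed
  have left_inv: "?R p (?R (qcnj p) (Delta_op A p x)) = x" if "x \<in> square_domain D A" for x
    using that square_domain_iff[of x p] by (simp add: Delta_op_eq_shifted_qcnj R_eq bij)
  have bij_Delta: "bij_betw (Delta_op A p) (square_domain D A) UNIV"
    by (rule bij_betw_byWitness[where f' = "\<lambda>y. ?R p (?R (qcnj p) y)"])
      (use left_inv right_inv in auto)
  have "Q_op D A p y = ?R p (?R (qcnj p) y)" for y
    unfolding Q_op_def
    by (rule inv_into_f_eq[OF bij_betw_imp_inj_on[OF bij_Delta]]) (rule right_inv)+
  then have "Q_op D A p = (\<lambda>y. ?R p (?R (qcnj p) y))" by (rule ext)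
  then have "bounded_linear (Q_op D A p)"
    by (simp add: bounded_linear_compose bounded_linear_inv_shifted closed_op bij)
  then show ?thesis
    using bij_Delta right_linear_Q_op[OF bij_Delta] bounded_right_linearI
    by (auto simp: S_resolvent_set_def)
qed

end


section \<open>The bound on the Cassini distance to the S-spectrum\<close>

lemma norm_Delta_quat_qcnj: "norm (Delta_quat q (qcnj p)) = norm (Delta_quat q p)"
proof -
  have "Delta_quat q (qcnj p) = qcnj (Delta_quat q p)"
    by (simp add: Delta_quat_def quat_eq_iff power2_eq_square del: of_real_mult)
  moreover have "norm (qcnj s) = norm s" for s by (simp add: norm_quat_def)
  ultimately show ?thesis by simp
qed

theorem corollary2p11:
  fixes D :: "'x::banach_quat_bimodule set"
    and A :: "'x \<Rightarrow> 'x"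
    and q\<^sub>0 :: quat
  assumes "right_submodule D"
    and "right_linear_on D A"
    and "closed_operator D A"
    and "S_resolvent_set D A \<inter> \<real> \<noteq> {}"
    and "q\<^sub>0 \<in> S_resolvent_set D A"
  shows "cassini_set q\<^sub>0 (S_spectrum D A) \<ge> 1 / ereal (sqrt (op_norm (Q_op D A q\<^sub>0)))"
  unfolding cassini_set_def
proof (rule INF_greatest)
  interpret right_linear_operator D A
    using assms(1,2) by (rule right_linear_operator.intro)
  fix p assume p: "p \<in> S_spectrum D A"
  define N where "N = op_norm (Q_op D A q\<^sub>0)"
  define d where "d = norm (Delta_quat q\<^sub>0 p)"
  \<comment> \<open>Conjugating \<open>p\<close> leaves \<open>d\<close> unchanged, so \<open>N * d < 1\<close> would make both \<open>A - p\<close> and \<open>A - p\<^sup>*\<close>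
    bijective.\<close>
  have "1 \<le> N * d"
  proof (rule ccontr)
    assume "\<not> 1 \<le> N * d"
    then have "bij_betw (shifted A p) D UNIV" "bij_betw (shifted A (qcnj p)) D UNIV"
      using bij_shifted[OF assms(5)] unfolding N_def d_def by (simp_all add: norm_Delta_quat_qcnj)
    then have "p \<in> S_resolvent_set D A" by (rule S_resolventI[OF assms(3)])
    with p show False by (simp add: S_spectrum_def)
  qed
  moreover have "d \<ge> 0" by (simp add: d_def)
  ultimately have "N > 0" using mult_nonpos_nonneg[of N d] by linarith
  have "1 \<le> sqrt (N * d)" using \<open>1 \<le> N * d\<close> by simp
  then have "1 / sqrt N \<le> sqrt d"
    using \<open>N > 0\<close> by (simp add: pos_divide_le_eq real_sqrt_mult mult.commute)
  moreover have "1 / ereal (sqrt N) = ereal (1 / sqrt N)"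
    using \<open>N > 0\<close> by (simp add: one_ereal_def)
  ultimately show "1 / ereal (sqrt (op_norm (Q_op D A q\<^sub>0))) \<le> ereal (cassini p q\<^sub>0)"
    by (simp add: cassini_def flip: N_def d_def)
qed

end
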